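(* Let $k\ge 3$ and $v>k$ be integers, and let $\mathcal{S}$ be a Steiner system $S(2,k,v)$. Put $r=\frac{v-1}{k-1}$. Then the point-block incidence graph of $\mathcal{S}$ is a (bipartite biregular) $(k,r;6)$-Moore cage; that is, it is a bipartite biregular $(k,r;6)$-graph whose order equals $n_0(k,r;6)=\left\lceil \frac{(r+k)(rk-r+1)}{k}\right\rceil$.
   Context: All graphs are finite and simple. A Steiner system $S(2,k,v)$ is a collection of $k$-element subsets (blocks) of a $v$-element set (of points) such that every 2-element subset of points is contained in exactly one block. Its point-block incidence graph is the bipartite graph whose vertices are the points and the blocks, a point being adjacent to a block if and only if it belongs to it. For an even integer $g$, a bipartite biregular $(n,m;g)$-graph is a bipartite graph of girth exactly $g$ with a bipartition such that all vertices in one partite set have degree $n$ and all vertices in the other partite set have degree $m$ (here the case $n=m$ is allowed, in which case the graph is regular). For $n\le m$ put $n_0(n,m;6)=\left\lceil \frac{(m+n)(mn-m+1)}{n}\right\rceil$; this is a known lower bound on the order (number of vertices) of a bipartite biregular $(n,m;6)$-graph. An $(n,m;6)$-Moore cage is a bipartite biregular $(n,m;6)$-graph of order exactly $n_0(n,m;6)$. *)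

theory Defs
  imports Complex_Main "HOL-Library.Extended_Nat" "Graph_Theory.Pair_Digraph"
begin

definition steiner_system :: "'a set \<Rightarrow> 'a set set \<Rightarrow> nat \<Rightarrow> nat \<Rightarrow> bool" where
  "steiner_system V \<B> k v \<longleftrightarrow>
     finite V \<and> card V = v \<and>
     (\<forall>b\<in>\<B>. b \<subseteq> V \<and> card b = k) \<and>
     (\<forall>e. e \<subseteq> V \<and> card e = 2 \<longrightarrow> (\<exists>!b. b \<in> \<B> \<and> e \<subseteq> b))"

text \<open>
  Finite simple undirected graphs are represented by \<^locale>\<open>pair_graph\<close>: finite, loop-free,
  symmetric arc relations. An edge is a pair of opposite arcs, so the degree of a vertex
  is its out-degree.
\<close>

definition incidence_graph :: "'a set \<Rightarrow> 'a set set \<Rightarrow> ('a + 'a set) pair_pre_digraph" where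
  "incidence_graph V \<B> =
     \<lparr> pverts = V <+> \<B>,
       parcs = {(Inl p, Inr b) | p b. p \<in> V \<and> b \<in> \<B> \<and> p \<in> b} \<union>
               {(Inr b, Inl p) | p b. p \<in> V \<and> b \<in> \<B> \<and> p \<in> b} \<rparr>"

text \<open>
  The condition on the length excludes the closed walks that traverse a single edge
  back and forth, which count as directed cycles. The girth of a forest is \<open>\<infinity>\<close>.
\<close>

definition girth :: "'a pair_pre_digraph \<Rightarrow> enat" where
  "girth G = (INF p \<in> {p. pre_digraph.cycle (with_proj G) p \<and> 3 \<le> length p}. enat (length p))"

definition bipartition :: "'a pair_pre_digraph \<Rightarrow> 'a set \<Rightarrow> 'a set \<Rightarrow> bool" where
  "bipartition G X Y \<longleftrightarrow>
     X \<union> Y = pverts G \<and> X \<inter> Y = {} \<and> parcs G \<subseteq> X \<times> Y \<union> Y \<times> X"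

definition bipartite_biregular_graph :: "'a pair_pre_digraph \<Rightarrow> nat \<Rightarrow> nat \<Rightarrow> nat \<Rightarrow> bool" where
  "bipartite_biregular_graph G n m g \<longleftrightarrow>
     pair_graph G \<and> girth G = enat g \<and>
     (\<exists>X Y. bipartition G X Y \<and>
        (\<forall>x\<in>X. out_degree (with_proj G) x = n) \<and>
        (\<forall>y\<in>Y. out_degree (with_proj G) y = m))"

definition moore_bound_6 :: "nat \<Rightarrow> nat \<Rightarrow> int" where
  "moore_bound_6 n m =
     \<lceil>(real m + real n) * (real m * real n - real m + 1) / real n\<rceil>"

text \<open>The bound is meant for \<open>n \<le> m\<close> only and is not symmetric in \<open>n\<close> and \<open>m\<close>.\<close>

definition moore_cage_6 :: "'a pair_pre_digraph \<Rightarrow> nat \<Rightarrow> nat \<Rightarrow> bool" where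
  "moore_cage_6 G n m \<longleftrightarrow>
     n \<le> m \<and> bipartite_biregular_graph G n m 6 \<and>
     int (card (pverts G)) = moore_bound_6 n m"

end

theory Submission
  imports Defs
begin

text \<open>
  Counting pairs of points through a fixed point gives the degree \<open>r = (v - 1) / (k - 1)\<close>, and
  counting incidences gives \<open>v r / k\<close> blocks, so that the order \<open>v + v r / k\<close> equals
  \<open>(r + k) (r k - r + 1) / k\<close> because \<open>v = r (k - 1) + 1\<close>. Joining a point outside a block
  to the \<open>k\<close> points of that block shows \<open>k \<le> r\<close>. A closed walk in a bipartite graph has even
  length, and a cycle of length 4 would be two points on two common blocks; a triangle of points not
  on a common block yields a cycle of length 6.
\<close>

locale proper_steiner_system =
  fixes V :: "'a set" and \<B> :: "'a set set" and k v :: nat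
  assumes three_le_k: "3 \<le> k" and k_less_v: "k < v"
    and steiner: "steiner_system V \<B> k v"
begin

definition blocks_through :: "'a \<Rightarrow> 'a set set" where
  "blocks_through p = {b \<in> \<B>. p \<in> b}"

lemma finite_points: "finite V" and card_points: "card V = v"
  and block_subset: "b \<in> \<B> \<Longrightarrow> b \<subseteq> V" and card_block: "b \<in> \<B> \<Longrightarrow> card b = k"
  using steiner by (auto simp: steiner_system_def)

lemma finite_block: "b \<in> \<B> \<Longrightarrow> finite b"
  using block_subset finite_points finite_subset by blast

lemma finite_blocks: "finite \<B>"
  by (rule finite_subset[of _ "Pow V"]) (use block_subset finite_points in auto)

lemma finite_blocks_through: "finite (blocks_through p)"
  using finite_blocks by (simp add: blocks_through_def)

lemma ex1_block:
  assumes "p \<in> V" "q \<in> V" "p \<noteq> q"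
  shows "\<exists>!b. b \<in> \<B> \<and> p \<in> b \<and> q \<in> b"
proof -
  have "\<exists>!b. b \<in> \<B> \<and> {p, q} \<subseteq> b"
    using steiner assms unfolding steiner_system_def
    by (metis bot.extremum card_2_iff insert_subset)
  then show ?thesis by simp
qed

text \<open>The uniqueness half of the Steiner property, in the form used below: distinct blocks
  meet in at most one point.\<close>

lemma block_eqI:
  assumes "b \<in> \<B>" "c \<in> \<B>" "p \<noteq> q" "p \<in> b" "q \<in> b" "p \<in> c" "q \<in> c"
  shows "b = c"
  using ex1_block[of p q] block_subset[of b] assms by blast

text \<open>Deleting \<open>p\<close> from the blocks through it partitions the remaining points
  into classes of size \<open>k - 1\<close>. The product form avoids division of natural
  numbers.\<close>

lemma card_blocks_through:
  assumes "p \<in> V"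
  shows "card (blocks_through p) * (k - 1) = v - 1"
proof -
  have "V - {p} = (\<Union>b\<in>blocks_through p. b - {p})"
  proof
    show "V - {p} \<subseteq> (\<Union>b\<in>blocks_through p. b - {p})"
      using ex1_block[OF assms] by (fastforce simp: blocks_through_def)
    show "(\<Union>b\<in>blocks_through p. b - {p}) \<subseteq> V - {p}"
      using block_subset by (auto simp: blocks_through_def)
  qed
  moreover have "(b - {p}) \<inter> (c - {p}) = {}"
    if "b \<in> blocks_through p" "c \<in> blocks_through p" "b \<noteq> c" for b c
  proof -
    have "q = p" if "q \<in> b" "q \<in> c" for q
      using that \<open>b \<in> blocks_through p\<close> \<open>c \<in> blocks_through p\<close> \<open>b \<noteq> c\<close> block_eqI[of b c p q]
      by (auto simp: blocks_through_def)
    then show ?thesis by blast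
  qed
  moreover have "finite (b - {p})" if "b \<in> blocks_through p" for b
    using that finite_block by (auto simp: blocks_through_def)
  \<comment> \<open>\<open>UN_simps\<close> would pull the difference with \<open>{p}\<close> out of
    the union and destroy the disjoint family that \<open>card_UN_disjoint\<close> needs.\<close>
  ultimately have "card (V - {p}) = (\<Sum>b\<in>blocks_through p. card (b - {p}))"
    using finite_blocks_through by (simp add: card_UN_disjoint del: UN_simps)
  also have "\<dots> = (\<Sum>b\<in>blocks_through p. k - 1)"
    by (rule sum.cong) (auto simp: blocks_through_def card_block)
  finally show ?thesis
    using assms finite_points card_points by simp
qed

text \<open>Double counting of incident point-block pairs, first by blocks and then by
  points.\<close>

lemma card_blocks:
  assumes "\<And>p. p \<in> V \<Longrightarrow> card (blocks_through p) = r"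
  shows "k * card \<B> = r * v"
proof -
  have "k * card \<B> = (\<Sum>b\<in>\<B>. card {p \<in> V. p \<in> b})"
    using block_subset card_block
    by (simp add: Collect_conj_eq Int_absorb1 mult.commute)
  also have "\<dots> = r * card V"
    by (rule sum_multicount[OF finite_blocks finite_points])
      (use assms in \<open>auto simp: blocks_through_def\<close>)
  finally show ?thesis by (simp add: card_points)
qed

lemma point_outside_block:
  assumes "b \<in> \<B>"
  obtains p where "p \<in> V" "p \<notin> b"
proof -
  have "b \<noteq> V"
    using assms card_block card_points k_less_v by auto
  then show thesis
    using assms block_subset that by blast
qed

lemma ex_block: "\<exists>b. b \<in> \<B>"
proof -
  obtain p q where "p \<in> V" "q \<in> V" "p \<noteq> q"
    using card_points three_le_k k_less_v card_le_Suc0_iff_eq[OF finite_points] by force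
  then show ?thesis using ex1_block by blast
qed

text \<open>The blocks joining \<open>p\<close> to the points of \<open>b\<close> are pairwise
  distinct: one that served two points of \<open>b\<close> would share both with \<open>b\<close>,
  hence equal \<open>b\<close>, which misses \<open>p\<close>.\<close>

lemma le_card_blocks_through:
  assumes "b \<in> \<B>" "p \<in> V" "p \<notin> b"
  shows "k \<le> card (blocks_through p)"
proof -
  have "\<exists>c. c \<in> \<B> \<and> p \<in> c \<and> q \<in> c" if "q \<in> b" for q
    using ex1_block[of p q] assms block_subset that by blast
  then obtain join where join: "\<And>q. q \<in> b \<Longrightarrow> join q \<in> \<B> \<and> p \<in> join q \<and> q \<in> join q"
    by metis
  have "inj_on join b"
    by (rule inj_onI) (metis assms(1,3) block_eqI join)
  moreover have "join ` b \<subseteq> blocks_through p"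
    using join by (auto simp: blocks_through_def)
  ultimately have "card b \<le> card (blocks_through p)"
    using finite_blocks_through by (rule card_inj_on_le)
  then show ?thesis using assms(1) card_block by simp
qed

abbreviation "G \<equiv> incidence_graph V \<B>"

lemma pair_graph_incidence: "pair_graph G"
proof
  have "parcs G \<subseteq> pverts G \<times> pverts G"
    by (auto simp: incidence_graph_def)
  then show "finite (parcs G)"
    by (rule finite_subset) (simp add: incidence_graph_def finite_points finite_blocks)
  show "symmetric (with_proj G)"
    by (auto simp: symmetric_def incidence_graph_def intro!: symI)
qed (auto simp: incidence_graph_def finite_points finite_blocks)

lemma out_degree_point:
  assumes "p \<in> V"
  shows "out_degree (with_proj G) (Inl p) = card (blocks_through p)"
proof -
  have "out_arcs (with_proj G) (Inl p) = (\<lambda>b. (Inl p, Inr b)) ` blocks_through p"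
    using assms by (auto simp: incidence_graph_def blocks_through_def)
  then show ?thesis
    by (simp add: out_degree_def card_image inj_on_def)
qed

lemma out_degree_block:
  assumes "b \<in> \<B>"
  shows "out_degree (with_proj G) (Inr b) = k"
proof -
  have "out_arcs (with_proj G) (Inr b) = (\<lambda>p. (Inr b, Inl p)) ` b"
    using assms block_subset[OF assms] by (auto simp: incidence_graph_def)
  then show ?thesis
    using assms by (simp add: out_degree_def card_image inj_on_def card_block)
qed

text \<open>Restates cycles by the recursive functions on arc lists, so that simplification can
  evaluate the condition on an explicit list.\<close>

lemma cycle_incidence_iff:
  "pre_digraph.cycle (with_proj G) p \<longleftrightarrow>
     (\<exists>u \<in> V <+> \<B>. set p \<subseteq> parcs G \<and> pcas u p u \<and> distinct (tl (pawalk_verts u p)) \<and> p \<noteq> [])"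
  by (auto simp: pre_digraph.cycle_def pre_digraph.awalk_def cas_with_proj_eq
      awalk_verts_with_proj_eq incidence_graph_def)

text \<open>Every arc switches between points and blocks. The two ends are kept separate so that the
  induction can move the start; a closed walk is the case \<open>u = w\<close>.\<close>

lemma even_length_iff_same_side:
  assumes "set p \<subseteq> parcs G" "pcas u p w"
  shows "even (length p) \<longleftrightarrow> isl u = isl w"
  using assms by (induction p arbitrary: u) (auto simp: incidence_graph_def)

text \<open>Opposite vertices of such a cycle would be two distinct points and two distinct blocks,
  each of the points lying on both blocks.\<close>

lemma no_cycle_4:
  assumes "pre_digraph.cycle (with_proj G) p"
  shows "length p \<noteq> 4"
proof
  assume "length p = 4"
  then obtain e1 e2 e3 e4 where p: "p = [e1, e2, e3, e4]"
    by (auto simp: numeral_eq_Suc length_Suc_conv)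
  obtain u u2 u3 u4 where e: "e1 = (u, u2)" "e2 = (u2, u3)" "e3 = (u3, u4)" "e4 = (u4, u)"
    using assms unfolding cycle_incidence_iff p by (cases e1; cases e2; cases e3; cases e4) auto
  have arcs: "(u, u2) \<in> parcs G" "(u2, u3) \<in> parcs G" "(u3, u4) \<in> parcs G" "(u4, u) \<in> parcs G"
    and ne: "u2 \<noteq> u4" "u \<noteq> u3"
    using assms unfolding cycle_incidence_iff p e by auto
  show False
  proof (cases u)
    case (Inl x)
    with arcs obtain b y c where "u2 = Inr b" "u3 = Inl y" "u4 = Inr c"
      by (auto simp: incidence_graph_def)
    then show False
      using arcs ne Inl block_eqI[of b c x y] by (auto simp: incidence_graph_def)
  next
    case (Inr b)
    with arcs obtain x c y where "u2 = Inl x" "u3 = Inr c" "u4 = Inl y"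
      by (auto simp: incidence_graph_def)
    then show False
      using arcs ne Inr block_eqI[of b c x y] by (auto simp: incidence_graph_def)
  qed
qed

lemma cycle_length_ge:
  assumes "pre_digraph.cycle (with_proj G) p" "3 \<le> length p"
  shows "6 \<le> length p"
proof -
  have "even (length p)"
    using assms(1) even_length_iff_same_side unfolding cycle_incidence_iff by blast
  moreover have "length p \<noteq> 4"
    using assms(1) by (rule no_cycle_4)
  ultimately show ?thesis
    using assms(2) by presburger
qed

lemma ex_cycle_6: "\<exists>p. pre_digraph.cycle (with_proj G) p \<and> length p = 6"
proof -
  obtain b where b: "b \<in> \<B>"
    using ex_block by blast
  obtain x y where xy: "x \<in> b" "y \<in> b" "x \<noteq> y"
    using card_block[OF b] three_le_k card_le_Suc0_iff_eq[OF finite_block[OF b]] by force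
  obtain z where z: "z \<in> V" "z \<notin> b"
    using point_outside_block[OF b] .
  have V: "x \<in> V" "y \<in> V"
    using b block_subset xy by auto
  obtain c where c: "c \<in> \<B>" "y \<in> c" "z \<in> c"
    using ex1_block[of y z] V xy z by metis
  obtain d where d: "d \<in> \<B>" "z \<in> d" "x \<in> d"
    using ex1_block[of z x] V xy z by metis
  \<comment> \<open>The point \<open>z\<close> separates \<open>b\<close> from \<open>c\<close> and
    \<open>d\<close>. If \<open>c = d\<close>, this block would contain \<open>x\<close> and
    \<open>y\<close> and so equal \<open>b\<close>.\<close>
  have "b \<noteq> c" "b \<noteq> d" "c \<noteq> d"
    using b c d xy z block_eqI[of b c x y] by auto
  then have "pre_digraph.cycle (with_proj G)
      [(Inl x, Inr b), (Inr b, Inl y), (Inl y, Inr c), (Inr c, Inl z), (Inl z, Inr d), (Inr d, Inl x)]"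
    unfolding cycle_incidence_iff
    using b c d xy z V by (auto simp: incidence_graph_def intro!: bexI[of _ "Inl x"])
  then show ?thesis by fastforce
qed

lemma girth_incidence: "girth G = 6"
proof (rule antisym)
  obtain p where "pre_digraph.cycle (with_proj G) p" "length p = 6"
    using ex_cycle_6 by blast
  then show "girth G \<le> 6"
    unfolding girth_def by (intro INF_lower2[of p]) (auto simp: numeral_eq_enat)
  show "6 \<le> girth G"
    unfolding girth_def by (rule INF_greatest) (auto simp: numeral_eq_enat dest: cycle_length_ge)
qed

text \<open>The existential over naturals makes the integrality of the quotient part of the claim;
  the witness is the number of blocks through a point.\<close>

lemma moore_cage_incidence:
  "\<exists>r::nat. real r = (real v - 1) / (real k - 1) \<and> moore_cage_6 G k r"
proof -
  obtain b where b: "b \<in> \<B>"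
    using ex_block by blast
  obtain z where z: "z \<in> V" "z \<notin> b"
    using point_outside_block[OF b] .
  \<comment> \<open>Counting at a point outside \<open>b\<close> lets the same \<open>z\<close>
    yield \<open>k \<le> r\<close> at the end.\<close>
  define r where "r = card (blocks_through z)"
  have rk: "r * (k - 1) = v - 1"
    unfolding r_def by (rule card_blocks_through[OF z(1)])
  \<comment> \<open>Both counts have the same product with \<open>k - 1\<close>, which is positive
    and cancels.\<close>
  have r: "card (blocks_through p) = r" if "p \<in> V" for p
    using card_blocks_through[OF that] rk[symmetric] three_le_k by simp
  have v: "real v = real r * real k - real r + 1"
  proof -
    have "real r * (real k - 1) = real v - 1"
      using arg_cong[OF rk, of real] three_le_k k_less_v by (simp add: of_nat_diff)
    then show ?thesis by (simp add: algebra_simps)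
  qed
  \<comment> \<open>Blocks form the first side, since they have degree \<open>k\<close> and the
    points have degree \<open>r\<close>.\<close>
  have "bipartition G (Inr ` \<B>) (Inl ` V)"
    by (auto simp: bipartition_def incidence_graph_def)
  then have biregular: "bipartite_biregular_graph G k r 6"
    unfolding bipartite_biregular_graph_def
    using pair_graph_incidence girth_incidence out_degree_point out_degree_block r
    by (auto simp: numeral_eq_enat)
  have "card (pverts G) = v + card \<B>"
    by (simp add: incidence_graph_def card_Plus finite_points finite_blocks card_points)
  moreover have "real k * real (card \<B>) = real r * real v"
    using card_blocks[OF r] by (metis of_nat_mult)
  ultimately have "real (card (pverts G)) = (real r + real k) * real v / real k"
    using three_le_k by (simp add: field_simps)
  \<comment> \<open>The quotient inside the ceiling is already the integer order of the graph, so
    rounding changes nothing.\<close>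
  then have "int (card (pverts G)) = moore_bound_6 k r"
    unfolding moore_bound_6_def v[symmetric] by (metis ceiling_of_nat)
  moreover have "k \<le> r"
    unfolding r_def by (rule le_card_blocks_through[OF b z])
  moreover have "real r = (real v - 1) / (real k - 1)"
    using v three_le_k by (simp add: field_simps)
  ultimately show ?thesis
    using biregular by (auto simp: moore_cage_6_def)
qed

end

theorem theorem8:
  fixes V :: "'a set" and \<B> :: "'a set set" and k v :: nat
  assumes "k \<ge> 3" and "v > k"
    and "steiner_system V \<B> k v"
  shows "\<exists>r::nat. real r = (real v - 1) / (real k - 1) \<and>
           moore_cage_6 (incidence_graph V \<B>) k r"
  using assms by (intro proper_steiner_system.moore_cage_incidence proper_steiner_system.intro)

end
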